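(* Let $H$ be a quaternion skew field with centre $F$. Let $M_1,M_2$ be lines of $\mathbb{P}(H)$, and let $L_1$ and $L_2$ be the uniquely determined lines through the point $F1$ such that $L_1\parallel_{\ell}M_1$ and $L_2\parallel_{r}M_2$. Then the following are equivalent. (a) $M_1\mathrel{\pi_{\ell r}}M_2$. (b) There exist $e_1,e_2\in H^*$ with $e_1M_1=M_2e_2$. (c) $\mathcal{S}_{\ell}(M_1)\cap\mathcal{S}_{r}(M_2)\neq\emptyset$. (d) There exists a line $M$ of $\mathbb{P}(H)$ such that $\mathcal{S}_{\ell}(M_1)\cap\mathcal{S}_{r}(M_2)=\{M,M^\perp\}$. (e) $L_1\cong L_2$, i.e. $L_1$ and $L_2$ are $F$-isomorphic. (f) There exists an $e\in H^*$ with $e^{-1}L_1e=L_2$.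
   Context: A quaternion skew field $H$ with centre $F$ is a quaternion algebra over the field $F$ (of any characteristic), $4$-dimensional over $F$, that is a skew field with centre $F$; $H^*:=H\setminus\{0\}$. Let $q\mapsto\overline{q}$ be the conjugation of $H$, i.e. the unique $F$-linear antiautomorphism with $q+\overline{q}\in F$ and $q\overline{q}\in F$ for all $q\in H$. The symmetric bilinear form $\langle\cdot,\cdot\rangle\colon H\times H\to F$ is $\langle p,q\rangle=p\overline{q}+q\overline{p}$, and $X^\perp$ denotes the set of all quaternions orthogonal with respect to this form to all elements of $X\subseteq H$. The projective space $\mathbb{P}(H)$ is the set of all subspaces of the $F$-vector space $H$; its points and lines are the subspaces of vector dimension one and two, respectively. For lines $M,N$: $M$ is left parallel to $N$, $M\parallel_{\ell}N$, if there is a $c\in H^*$ with $cM=N$; $M$ is right parallel to $N$, $M\parallel_{r}N$, if there is a $d\in H^*$ with $Md=N$. The left and right parallel classes of a line $M$ are denoted by $\mathcal{S}_{\ell}(M)$ and $\mathcal{S}_{r}(M)$. The relation $\pi_{\ell r}$ is the equivalence relation on the set of lines generated by $\parallel_{\ell}$ and $\parallel_{r}$. The lines through the point $F1$ (with $1\in H$) are precisely the two-dimensional $F$-subalgebras of $H$, i.e. the maximal (commutative) subfields of $H$. Two such lines are $F$-isomorphic ($L_1\cong L_2$) if there is a ring isomorphism $L_1\to L_2$ fixing $F$ elementwise. *)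

theory Defs
  imports Complex_Main
begin

text \<open>
  The field \<open>F\<close> is the type of scalars of the \<open>F\<close>-algebra \<open>H\<close>; inside \<open>H\<close> it appears as \<open>F1\<close>,
  the set of all \<open>a \<cdot> 1\<close>. A quaternion algebra over \<open>F\<close> (in any characteristic) is a
  four-dimensional \<open>F\<close>-algebra that is central and simple; simplicity is automatic in a skew field.
  The library's dimension of an infinite-dimensional space is 0, so the last axiom
  includes finiteness.
\<close>

locale quaternion_skew_field = vector_space scale
  for scale :: "'f::field \<Rightarrow> 'h::division_ring \<Rightarrow> 'h" +
  assumes scale_mult_left: "scale a (x * y) = scale a x * y"
    and scale_mult_right: "scale a (x * y) = x * scale a y"
    and centre_eq: "{z. \<forall>x. z * x = x * z} = range (\<lambda>a. scale a 1)"
    and dim_eq_4: "dim UNIV = 4"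

text \<open>\<open>F1\<close>, which is both the copy of \<open>F\<close> in \<open>H\<close> and a point of the projective space.\<close>

definition ground :: "('f::field \<Rightarrow> 'h::division_ring \<Rightarrow> 'h) \<Rightarrow> 'h set"
  where "ground scale = range (\<lambda>a. scale a 1)"

definition is_conjugation :: "('f::field \<Rightarrow> 'h::division_ring \<Rightarrow> 'h) \<Rightarrow> ('h \<Rightarrow> 'h) \<Rightarrow> bool"
  where "is_conjugation scale \<kappa> \<longleftrightarrow>
    Vector_Spaces.linear scale scale \<kappa> \<and> bij \<kappa> \<and> (\<forall>p q. \<kappa> (p * q) = \<kappa> q * \<kappa> p) \<and>
    (\<forall>q. q + \<kappa> q \<in> ground scale \<and> q * \<kappa> q \<in> ground scale)"

definition qconj :: "('f::field \<Rightarrow> 'h::division_ring \<Rightarrow> 'h) \<Rightarrow> 'h \<Rightarrow> 'h"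
  where "qconj scale = (THE \<kappa>. is_conjugation scale \<kappa>)"

text \<open>The values of the form lie in \<open>F1\<close>; they are kept as elements of \<open>H\<close>.\<close>

definition qform :: "('f::field \<Rightarrow> 'h::division_ring \<Rightarrow> 'h) \<Rightarrow> 'h \<Rightarrow> 'h \<Rightarrow> 'h"
  where "qform scale p q = p * qconj scale q + q * qconj scale p"

definition perp :: "('f::field \<Rightarrow> 'h::division_ring \<Rightarrow> 'h) \<Rightarrow> 'h set \<Rightarrow> 'h set"
  where "perp scale X = {p. \<forall>x\<in>X. qform scale p x = 0}"

definition lines :: "('f::field \<Rightarrow> 'h::division_ring \<Rightarrow> 'h) \<Rightarrow> 'h set set"
  where "lines scale = {M. module.subspace scale M \<and> vector_space.dim scale M = 2}"

definition left_parallel :: "('f::field \<Rightarrow> 'h::division_ring \<Rightarrow> 'h) \<Rightarrow> ('h set \<times> 'h set) set"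
  where "left_parallel scale =
    {(M, N). M \<in> lines scale \<and> N \<in> lines scale \<and> (\<exists>c. c \<noteq> 0 \<and> (\<lambda>x. c * x) ` M = N)}"

definition right_parallel :: "('f::field \<Rightarrow> 'h::division_ring \<Rightarrow> 'h) \<Rightarrow> ('h set \<times> 'h set) set"
  where "right_parallel scale =
    {(M, N). M \<in> lines scale \<and> N \<in> lines scale \<and> (\<exists>d. d \<noteq> 0 \<and> (\<lambda>x. x * d) ` M = N)}"

definition left_class :: "('f::field \<Rightarrow> 'h::division_ring \<Rightarrow> 'h) \<Rightarrow> 'h set \<Rightarrow> 'h set set"
  where "left_class scale M = left_parallel scale `` {M}"

definition right_class :: "('f::field \<Rightarrow> 'h::division_ring \<Rightarrow> 'h) \<Rightarrow> 'h set \<Rightarrow> 'h set set"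
  where "right_class scale M = right_parallel scale `` {M}"

text \<open>The smallest equivalence relation on the set of lines that contains both parallelisms.\<close>

definition pi_lr :: "('f::field \<Rightarrow> 'h::division_ring \<Rightarrow> 'h) \<Rightarrow> ('h set \<times> 'h set) set"
  where "pi_lr scale =
    \<Inter>{R. equiv (lines scale) R \<and> left_parallel scale \<subseteq> R \<and> right_parallel scale \<subseteq> R}"

text \<open>Meant for subrings of \<open>H\<close> that contain \<open>F1\<close>; \<open>\<phi> 1 = 1\<close> follows from fixing \<open>F1\<close>.\<close>

definition F_isomorphic :: "('f::field \<Rightarrow> 'h::division_ring \<Rightarrow> 'h) \<Rightarrow> 'h set \<Rightarrow> 'h set \<Rightarrow> bool"
  where "F_isomorphic scale L1 L2 \<longleftrightarrow>
    (\<exists>\<phi>. bij_betw \<phi> L1 L2 \<and>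
      (\<forall>x\<in>L1. \<forall>y\<in>L1. \<phi> (x + y) = \<phi> x + \<phi> y \<and> \<phi> (x * y) = \<phi> x * \<phi> y) \<and>
      (\<forall>a\<in>ground scale. \<phi> a = a))"

end

theory Submission
  imports Defs
begin

text \<open>
  Write \<open>C(q)\<close> for the centralizer of \<open>q\<close> and \<open>bar\<close> for the conjugation. For \<open>q\<close> outside \<open>F1\<close> the
  centralizer is a proper division subring of \<open>H\<close>; as \<open>H\<close> has dimension four, \<open>C(q)\<close> is the line
  through \<open>1\<close> and \<open>q\<close>. So the lines through \<open>F1\<close> are the sets \<open>C(q)\<close>, and every \<open>q\<close> satisfies a
  quadratic equation over \<open>F\<close>.

  Left and right multiplications commute, so two lines are related by \<open>\<pi>\<^sub>\<ell>\<^sub>r\<close> exactly when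
  \<open>M2 = a M1 b\<close> (lemma \<open>pi_lr_iff\<close>). This is (b), and a common value of \<open>e1 M1\<close> and \<open>M2 e2\<close> is an
  element of the intersection in (c). The members of the two classes are the lines \<open>u L1\<close> and
  \<open>L2 v\<close>. If they are equal, then \<open>u = l v\<close> with \<open>l \<in> L2\<close>, and \<open>L2 v = L2 u\<close> because \<open>L2 l = L2\<close>.
  So the intersection consists of the lines \<open>u L1\<close> with \<open>u L1 = L2 u\<close> (lemma \<open>class_inter_eq\<close>),
  which gives (f).

  For (d), let \<open>L1 = C(i)\<close> and let \<open>u\<close> and \<open>e\<close> be two solutions of \<open>u L1 = L2 u\<close>. Then
  \<open>w = e\<inverse> u\<close> normalizes the field \<open>C(i)\<close>, so \<open>w i w\<inverse>\<close> is \<open>i\<close> or \<open>bar i\<close>, the roots in that field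
  of the minimal polynomial of \<open>i\<close>. In the first case \<open>w C(i) = C(i)\<close>. In the second \<open>w C(i)\<close> is the
  set of all \<open>p\<close> with \<open>i p = p (bar i)\<close>. This set contains the nonzero commutators \<open>y = x i - i x\<close> and
  so equals \<open>y C(i)\<close>, which again consists of commutators with \<open>i\<close>. As commutators have trace zero, it
  is the orthogonal line of \<open>C(i)\<close>. Hence the intersection is \<open>{e L1, e L1\<^sup>\<bottom>}\<close>. If \<open>i\<close> is inseparable,
  then \<open>i = bar i\<close>, the two cases coincide, and \<open>L1\<close> is its own orthogonal line.

  That (e) implies (f) is the theorem of Skolem and Noether. If \<open>k\<close> is the image of \<open>i\<close> under the
  isomorphism, then \<open>i\<close> and \<open>k\<close> have the same trace and norm, and \<open>e = i x - x (bar k)\<close> satisfies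
  \<open>i e = e k\<close> for every \<open>x\<close>.

  All of this uses the conjugation, whose existence has to be derived from the axioms. Outside \<open>F1\<close>
  the value \<open>bar q\<close> is forced by the quadratic equation of \<open>q\<close>; the delicate point is additivity
  (lemma \<open>bar_add\<close>).
\<close>

section \<open>Images of sets under left and right multiplication\<close>

lemma image_mult_left_mult_left:
  "(\<lambda>x. c * x) ` (\<lambda>x. d * x) ` M = (\<lambda>x. (c * d) * x) ` M" for c d :: "'a::semigroup_mult"
  by (simp add: image_image mult.assoc)

lemma image_mult_right_mult_right:
  "(\<lambda>x. x * c) ` (\<lambda>x. x * d) ` M = (\<lambda>x. x * (d * c)) ` M" for c d :: "'a::semigroup_mult"
  by (simp add: image_image mult.assoc)

lemma image_mult_left_mult_right:
  "(\<lambda>x. c * x) ` (\<lambda>x. x * d) ` M = (\<lambda>x. x * d) ` (\<lambda>x. c * x) ` M" for c d :: "'a::semigroup_mult"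
  by (simp add: image_image mult.assoc)

lemma image_mult_1_left [simp]: "(\<lambda>x. 1 * x) ` M = M" for M :: "'a::monoid_mult set"
  by (simp add: image_def)

lemma image_mult_left_eq_iff:
  fixes c :: "'a::division_ring"
  assumes "c \<noteq> 0"
  shows "(\<lambda>x. c * x) ` M = N \<longleftrightarrow> M = (\<lambda>x. inverse c * x) ` N"
proof
  assume N: "(\<lambda>x. c * x) ` M = N"
  show "M = (\<lambda>x. inverse c * x) ` N"
    using assms by (simp add: N[symmetric] image_mult_left_mult_left)
next
  assume M: "M = (\<lambda>x. inverse c * x) ` N"
  show "(\<lambda>x. c * x) ` M = N"
    using assms by (simp add: M image_mult_left_mult_left)
qed

lemma image_mult_right_eq_iff:
  fixes c :: "'a::division_ring"
  assumes "c \<noteq> 0"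
  shows "(\<lambda>x. x * c) ` M = N \<longleftrightarrow> M = (\<lambda>x. x * inverse c) ` N"
proof
  assume N: "(\<lambda>x. x * c) ` M = N"
  show "M = (\<lambda>x. x * inverse c) ` N"
    using assms by (simp add: N[symmetric] image_mult_right_mult_right)
next
  assume M: "M = (\<lambda>x. x * inverse c) ` N"
  show "(\<lambda>x. x * c) ` M = N"
    using assms by (simp add: M image_mult_right_mult_right)
qed

lemma conjugate_iff:
  fixes e :: "'a::division_ring"
  assumes "e \<noteq> 0"
  shows "(\<lambda>x. inverse e * x * e) ` L1 = L2 \<longleftrightarrow>
    (\<lambda>x. inverse e * x) ` L1 = (\<lambda>x. x * inverse e) ` L2"
proof -
  have "(\<lambda>x. inverse e * x * e) ` L1 = (\<lambda>x. x * e) ` (\<lambda>x. inverse e * x) ` L1"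
    by (simp add: image_image)
  with image_mult_right_eq_iff[OF assms] show ?thesis
    by simp
qed

context quaternion_skew_field
begin

section \<open>The centre and multiplication maps\<close>

abbreviation Z :: "'h set"
  where "Z \<equiv> ground scale"

lemma Z_iff: "z \<in> Z \<longleftrightarrow> (\<forall>x. z * x = x * z)"
  using centre_eq unfolding ground_def by blast

lemma Z_commute: "z \<in> Z \<Longrightarrow> x * z = z * x"
  by (simp add: Z_iff)

lemma Z_left_commute: "z \<in> Z \<Longrightarrow> x * (z * y) = z * (x * y)"
  by (metis Z_iff mult.assoc)

lemmas Z_comm = Z_commute Z_left_commute

text \<open>
  Scalar multiplication is multiplication by an element of \<open>Z\<close>. From here on scalars are replaced by
  elements of \<open>Z\<close>, so that all computations take place in the ring.
\<close>

lemma scale_eq: "scale a x = scale a 1 * x"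
  using scale_mult_left[of a 1 x] by simp

lemma Z_scale_1 [simp]: "scale a 1 \<in> Z"
  by (simp add: ground_def)

lemma Z_0 [simp]: "0 \<in> Z"
  and Z_1 [simp]: "1 \<in> Z"
  by (simp_all add: Z_iff)

lemma Z_add [intro, simp]: "a \<in> Z \<Longrightarrow> b \<in> Z \<Longrightarrow> a + b \<in> Z"
  and Z_diff [intro, simp]: "a \<in> Z \<Longrightarrow> b \<in> Z \<Longrightarrow> a - b \<in> Z"
  and Z_uminus [intro, simp]: "a \<in> Z \<Longrightarrow> - a \<in> Z"
  by (simp_all add: Z_iff algebra_simps)

lemma Z_mult [intro, simp]: "a \<in> Z \<Longrightarrow> b \<in> Z \<Longrightarrow> a * b \<in> Z"
  unfolding Z_iff by (metis mult.assoc)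

lemma Z_inverse [intro, simp]: "a \<in> Z \<Longrightarrow> inverse a \<in> Z"
  unfolding Z_iff by (metis inverse_zero mult_commute_imp_mult_inverse_commute)

lemma Z_cancel:
  assumes "a \<in> Z" "a \<noteq> 0" "a * x \<in> Z"
  shows "x \<in> Z"
proof -
  have "inverse a * (a * x) \<in> Z"
    using assms by blast
  then show ?thesis
    using assms(2) by (simp flip: mult.assoc)
qed

lemma subspace_iff_Z:
  "subspace S \<longleftrightarrow> 0 \<in> S \<and> (\<forall>x\<in>S. \<forall>y\<in>S. x + y \<in> S) \<and> (\<forall>a\<in>Z. \<forall>x\<in>S. a * x \<in> S)"
  by (simp add: subspace_def ground_def flip: scale_eq)

lemma finite_dimensional:
  obtains B where "finite_dimensional_vector_space scale B"
proof -
  obtain B where B: "independent B" "UNIV \<subseteq> span B" "card B = dim UNIV"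
    by (rule basis_exists[of UNIV])
  then have "finite B"
    by (intro card_ge_0_finite) (simp add: dim_eq_4)
  with B have "finite_dimensional_vector_space scale B"
    by unfold_locales auto
  then show thesis ..
qed

lemma linear_mult_left: "Vector_Spaces.linear scale scale (\<lambda>x. c * x)"
  by (simp add: Vector_Spaces.linear_iff vector_space_axioms distrib_left scale_mult_right)

lemma linear_mult_right: "Vector_Spaces.linear scale scale (\<lambda>x. x * c)"
  by (simp add: Vector_Spaces.linear_iff vector_space_axioms distrib_right scale_mult_left)

lemma subspace_mult_left: "subspace S \<Longrightarrow> subspace ((\<lambda>x. c * x) ` S)"
  and subspace_mult_right: "subspace S \<Longrightarrow> subspace ((\<lambda>x. x * c) ` S)"
proof -
  interpret vector_space_pair scale scale
    by unfold_locales
  show "subspace S \<Longrightarrow> subspace ((\<lambda>x. c * x) ` S)"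
    by (rule linear_subspace_image[OF linear_mult_left])
  show "subspace S \<Longrightarrow> subspace ((\<lambda>x. x * c) ` S)"
    by (rule linear_subspace_image[OF linear_mult_right])
qed

lemma dim_mult_left:
  assumes "c \<noteq> 0" shows "dim ((\<lambda>x. c * x) ` S) = dim S"
proof -
  obtain B where "finite_dimensional_vector_space scale B"
    by (rule finite_dimensional)
  then interpret finite_dimensional_vector_space scale B .
  interpret finite_dimensional_vector_space_pair_1 scale B scale
    by unfold_locales
  show ?thesis
    using assms by (intro dim_image_eq linear_mult_left inj_onI) simp
qed

lemma dim_mult_right:
  assumes "c \<noteq> 0" shows "dim ((\<lambda>x. x * c) ` S) = dim S"
proof -
  obtain B where "finite_dimensional_vector_space scale B"
    by (rule finite_dimensional)
  then interpret finite_dimensional_vector_space scale B .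
  interpret finite_dimensional_vector_space_pair_1 scale B scale
    by unfold_locales
  show ?thesis
    using assms by (intro dim_image_eq linear_mult_right inj_onI) simp
qed

lemma lines_mult_left:
  "c \<noteq> 0 \<Longrightarrow> M \<in> lines scale \<Longrightarrow> (\<lambda>x. c * x) ` M \<in> lines scale"
  by (simp add: lines_def dim_mult_left subspace_mult_left)

lemma lines_mult_right:
  "c \<noteq> 0 \<Longrightarrow> M \<in> lines scale \<Longrightarrow> (\<lambda>x. x * c) ` M \<in> lines scale"
  by (simp add: lines_def dim_mult_right subspace_mult_right)

section \<open>Centralizers and lines through the point F1\<close>

definition centralizer :: "'h \<Rightarrow> 'h set"
  where "centralizer q = {x. x * q = q * x}"

lemma subspace_centralizer: "subspace (centralizer q)"
proof -
  have "a * x * q = q * (a * x)" if "a \<in> Z" "x * q = q * x" for a x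
    by (metis Z_iff mult.assoc that)
  moreover have "(x + y) * q = q * (x + y)" if "x * q = q * x" "y * q = q * y" for x y
    by (metis distrib_left distrib_right that)
  ultimately show ?thesis
    unfolding subspace_iff_Z centralizer_def by auto
qed

text \<open>
  If \<open>x\<close> lies outside the division subring \<open>C\<close>, then \<open>x C\<close> meets \<open>C\<close> only in \<open>0\<close>, and both subspaces
  have the same dimension; they fit into a four-dimensional space only if that dimension is at most 2.
\<close>

lemma dim_centralizer_le:
  assumes "q \<notin> Z" shows "dim (centralizer q) \<le> 2"
proof -
  obtain B where "finite_dimensional_vector_space scale B"
    by (rule finite_dimensional)
  then interpret finite_dimensional_vector_space scale B .
  obtain x where x: "x * q \<noteq> q * x"
    using assms by (metis Z_iff)
  let ?C = "centralizer q" and ?xC = "(\<lambda>y. x * y) ` centralizer q"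
  have "x \<noteq> 0" using x by auto
  have inter: "?xC \<inter> ?C = {0}"
  proof -
    have eq_0: "y = 0" if "y \<in> ?C" "x * y \<in> ?C" for y
    proof (rule ccontr)
      assume "y \<noteq> 0"
      have "y * q = q * y" "x * y * q = q * (x * y)"
        using that by (simp_all add: centralizer_def)
      then have "(x * q) * y = (q * x) * y"
        by (metis mult.assoc)
      with \<open>y \<noteq> 0\<close> x show False
        by simp
    qed
    have "0 \<in> ?C"
      by (simp add: centralizer_def)
    moreover from this have "0 \<in> ?xC"
      by (intro image_eqI[where x = 0]) simp_all
    moreover have "z = 0" if "z \<in> ?xC" "z \<in> ?C" for z
      using that(1)
    proof
      fix y assume "z = x * y" "y \<in> ?C"
      with that(2) eq_0[of y] show "z = 0" by simp
    qed
    ultimately show ?thesis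
      by (intro equalityI subsetI) simp_all
  qed
  have "subspace ?xC"
    by (intro subspace_mult_left subspace_centralizer)
  from dim_sums_Int[OF this subspace_centralizer[of q]]
  have "dim {u + v |u v. u \<in> ?xC \<and> v \<in> ?C} = dim ?C + dim ?C"
    using \<open>x \<noteq> 0\<close> by (simp add: inter dim_mult_left)
  moreover have "dim {u + v |u v. u \<in> ?xC \<and> v \<in> ?C} \<le> 4"
    using dim_subset[of _ UNIV] dim_eq_4 by simp
  ultimately show ?thesis by simp
qed

lemma span_1_insert: "span {1, q} = {a + b * q |a b. a \<in> Z \<and> b \<in> Z}"
proof -
  have "x \<in> span {1, q} \<longleftrightarrow> (\<exists>a b. x = scale a 1 + scale b 1 * q)" for x
  proof -
    have "x \<in> span {1, q} \<longleftrightarrow> (\<exists>a b. x - scale b 1 = scale a q)"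
      by (auto simp: span_breakdown_eq span_singleton)
    also have "\<dots> \<longleftrightarrow> (\<exists>a b. x = scale a 1 + scale b 1 * q)"
      by (metis add.commute diff_add_cancel add_diff_cancel_left' scale_eq)
    finally show ?thesis .
  qed
  then show ?thesis
    unfolding ground_def by (intro set_eqI, simp only: mem_Collect_eq) (blast intro: rangeI)
qed

lemma independent_1_insert:
  assumes "q \<notin> Z" shows "independent {q, 1}"
  using assms by (subst independent_insert) (auto simp: span_singleton ground_def)

text \<open>
  The centralizer contains the plane spanned by \<open>1\<close> and \<open>q\<close> and is itself at most two-dimensional. In
  particular \<open>q * q\<close> is a combination of \<open>1\<close> and \<open>q\<close>, which yields the quadratic equation of \<open>q\<close>.
\<close>

lemma centralizer_line:
  assumes q: "q \<notin> Z"
  shows "centralizer q \<in> lines scale"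
    and "centralizer q = {a + b * q |a b. a \<in> Z \<and> b \<in> Z}"
    and "\<And>L. L \<in> lines scale \<Longrightarrow> 1 \<in> L \<Longrightarrow> q \<in> L \<Longrightarrow> L = centralizer q"
proof -
  obtain B where "finite_dimensional_vector_space scale B"
    by (rule finite_dimensional)
  then interpret finite_dimensional_vector_space scale B .
  have "q \<noteq> 1"
    using q by auto
  then have dim: "dim (span {1, q}) = 2"
    using dim_span_eq_card_independent[OF independent_1_insert[OF q]] by (simp add: insert_commute)
  have sub: "span {1, q} \<subseteq> centralizer q"
    by (intro span_minimal subspace_centralizer) (auto simp: centralizer_def)
  have C: "span {1, q} = centralizer q"
    by (intro subspace_dim_equal subspace_span subspace_centralizer sub)
      (use dim dim_centralizer_le[OF q] in simp)
  then show "centralizer q = {a + b * q |a b. a \<in> Z \<and> b \<in> Z}"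
    by (simp add: span_1_insert)
  show "centralizer q \<in> lines scale"
    using dim C subspace_centralizer by (simp add: lines_def)
  fix L assume L: "L \<in> lines scale" "1 \<in> L" "q \<in> L"
  then have "span {1, q} \<subseteq> L"
    by (intro span_minimal) (auto simp: lines_def)
  then have "span {1, q} = L"
    by (intro subspace_dim_equal subspace_span) (use dim L in \<open>auto simp: lines_def\<close>)
  with C show "L = centralizer q" by simp
qed

lemma line_through_1_obtain:
  assumes "L \<in> lines scale" "1 \<in> L"
  obtains q where "q \<notin> Z" "q \<in> L" "L = centralizer q"
proof -
  have "\<not> L \<subseteq> Z"
  proof
    assume "L \<subseteq> Z"
    then have "L \<subseteq> span {1}"
      by (auto simp: ground_def span_singleton)
    then have "dim L \<le> card {1::'h}"
      by (intro dim_le_card) auto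
    then show False
      using assms(1) by (simp add: lines_def)
  qed
  then show thesis
    using that centralizer_line(3) assms by blast
qed

section \<open>The conjugation\<close>

text \<open>
  Two candidates for the conjugate differ by a central element \<open>d\<close> for which \<open>q * d\<close> is central too.
\<close>

lemma conjugate_unique:
  assumes "q \<notin> Z" "q + p \<in> Z" "q * p \<in> Z" "q + r \<in> Z" "q * r \<in> Z"
  shows "p = r"
proof (rule ccontr)
  assume "p \<noteq> r"
  have "(q + p) - (q + r) \<in> Z" "q * p - q * r \<in> Z"
    using assms by (blast intro: Z_diff)+
  then have "p - r \<in> Z" "q * (p - r) \<in> Z"
    by (simp_all add: right_diff_distrib)
  then have "(p - r) * q \<in> Z"
    by (metis Z_commute)
  then have "q \<in> Z"
    using \<open>p \<noteq> r\<close> \<open>p - r \<in> Z\<close> by (intro Z_cancel[of "p - r" q]) simp_all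
  with assms(1) show False ..
qed

lemma conjugate_exists:
  assumes "q \<notin> Z"
  obtains p where "q + p \<in> Z" "q * p \<in> Z"
proof -
  have "q * q \<in> centralizer q"
    by (simp add: centralizer_def mult.assoc)
  then obtain a b where "q * q = a + b * q" "a \<in> Z" "b \<in> Z"
    using centralizer_line(2)[OF assms] by blast
  then have "q + (b - q) \<in> Z" "q * (b - q) \<in> Z"
    by (simp_all add: right_diff_distrib Z_commute)
  then show thesis
    by (rule that)
qed

text \<open>
  A central \<open>q\<close> is treated apart, since every central \<open>p\<close> satisfies the two conditions then.
\<close>

definition bar :: "'h \<Rightarrow> 'h"
  where "bar q = (if q \<in> Z then q else (THE p. q + p \<in> Z \<and> q * p \<in> Z))"

lemma bar_Z [simp]: "q \<in> Z \<Longrightarrow> bar q = q"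
  by (simp add: bar_def)

lemma bar_eqI:
  assumes "q \<notin> Z" "q + p \<in> Z" "q * p \<in> Z"
  shows "bar q = p"
  unfolding bar_def using assms conjugate_unique by (auto intro!: the_equality)

lemma add_bar_in_Z [simp]: "q + bar q \<in> Z"
  and mult_bar_in_Z [simp]: "q * bar q \<in> Z"
  by (cases "q \<in> Z"; metis bar_eqI bar_Z conjugate_exists Z_add Z_mult)+

lemma mult_bar_commute: "bar q * q = q * bar q"
proof -
  have "(q + bar q) * q = q * (q + bar q)"
    by (metis Z_commute add_bar_in_Z)
  then show ?thesis
    by (simp add: distrib_left distrib_right)
qed

lemma bar_eq_0_iff [simp]: "bar q = 0 \<longleftrightarrow> q = 0"
  by (metis Z_0 add.right_neutral add_bar_in_Z bar_Z)

lemma bar_bar [simp]: "bar (bar q) = q"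
proof (cases "q \<in> Z")
  case False
  have "bar q \<notin> Z"
  proof
    assume "bar q \<in> Z"
    then have "q + bar q - bar q \<in> Z"
      by (intro Z_diff add_bar_in_Z)
    with False show False by simp
  qed
  moreover have "bar q + q \<in> Z" "bar q * q \<in> Z"
    by (simp_all add: mult_bar_commute add.commute[of "bar q"])
  ultimately show ?thesis
    by (rule bar_eqI)
qed simp

lemma bar_affine:
  assumes "a \<in> Z" "b \<in> Z"
  shows "bar (a + b * q) = a + b * bar q"
proof (cases "q \<in> Z \<or> b = 0")
  case True
  with assms show ?thesis by auto
next
  case False
  have "a + b * q \<notin> Z"
  proof
    assume "a + b * q \<in> Z"
    then have "(a + b * q) - a \<in> Z"
      using assms(1) by (rule Z_diff)
    with False assms Z_cancel[of b q] show False by simp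
  qed
  moreover have "(a + b * q) + (a + b * bar q) \<in> Z"
  proof -
    have "(a + b * q) + (a + b * bar q) = a + a + b * (q + bar q)"
      by (simp add: algebra_simps)
    then show ?thesis
      using assms by (metis Z_add Z_mult add_bar_in_Z)
  qed
  moreover have "(a + b * q) * (a + b * bar q) \<in> Z"
  proof -
    have "(a + b * q) * (a + b * bar q) = a * a + a * b * (q + bar q) + b * b * (q * bar q)"
      using assms by (simp add: distrib_left distrib_right mult.assoc Z_comm add_ac)
    then show ?thesis
      using assms by (metis Z_add Z_mult add_bar_in_Z mult_bar_in_Z)
  qed
  ultimately show ?thesis
    by (rule bar_eqI)
qed

lemma bar_mult_Z: "a \<in> Z \<Longrightarrow> bar (a * q) = a * bar q"
  using bar_affine[of 0 a q] by simp

lemma bar_add_commuting: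
  assumes "p * q = q * p"
  shows "bar (p + q) = bar p + bar q"
proof (cases "p \<in> Z")
  case True
  then show ?thesis
    using bar_affine[of p 1 q] by simp
next
  case False
  have "q \<in> centralizer p"
    using assms by (simp add: centralizer_def)
  then obtain a b where ab: "q = a + b * p" "a \<in> Z" "b \<in> Z"
    using centralizer_line(2)[OF False] by blast
  then have "p + q = a + (1 + b) * p"
    by (simp add: algebra_simps)
  then have "bar (p + q) = a + (1 + b) * bar p"
    using bar_affine[of a "1 + b" p] ab(2,3) by simp
  then show ?thesis
    using ab by (simp add: bar_affine distrib_right add_ac)
qed

text \<open>
  The case of Wedderburn's theorem that matters here: \<open>F\<close> is not the field with two elements. If it were,
  every noncentral element would have norm 1 and could only have trace 1, hence \<open>x * x = x + 1\<close>. Applying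
  this to \<open>p\<close>, \<open>q\<close>, \<open>p + q\<close> and \<open>p * q\<close> shows that \<open>p + 1\<close> and \<open>q + 1\<close> are inverse to each other, so
  \<open>p\<close> and \<open>q\<close> commute.
\<close>

lemma obtain_central_not_0_1:
  fixes p q :: 'h
  assumes "p * q \<noteq> q * p"
  obtains a where "a \<in> Z" "a \<noteq> 0" "a \<noteq> 1"
proof (rule ccontr)
  assume "\<not> thesis"
  then have Z01: "a = 0 \<or> a = 1" if "a \<in> Z" for a
    using that \<open>\<And>a. a \<in> Z \<Longrightarrow> a \<noteq> 0 \<Longrightarrow> a \<noteq> 1 \<Longrightarrow> thesis\<close> by blast
  have "1 + 1 = (0 :: 'h)"
    using Z01[OF Z_add[OF Z_1 Z_1]] by (metis add_cancel_left_right zero_neq_one)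
  \<comment> \<open>Characteristic 2 is used through two cancellation rules, so that no signs or numerals occur.\<close>
  then have double: "x + x = 0" for x :: 'h
    by (metis distrib_right mult_1_left mult_zero_left)
  then have double': "x + (x + y) = y" for x y :: 'h
    by (metis add.assoc add_0)
  have square: "x * x = x + 1" if "x \<notin> Z" for x
  proof -
    have "x \<noteq> 0" using that by auto
    then have norm: "x * bar x = 1"
      using Z01[of "x * bar x"] by simp
    have "x + bar x \<noteq> 0"
    proof
      assume "x + bar x = 0"
      then have "bar x = x"
        using double'[of x "bar x"] by simp
      with norm have "(x + 1) * (x + 1) = 0"
        by (simp add: distrib_left distrib_right double double' add_ac)
      then have "x = 1"
        using double'[of x 1] by simp
      with that show False by simp
    qed
    then have "x + bar x = 1"
      using Z01[of "x + bar x"] by simp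
    then have "bar x = x + 1"
      using double'[of x "bar x"] by simp
    with norm have "x * x + x = 1"
      by (simp add: distrib_left)
    then show ?thesis
      using double'[of x "x * x"] by (simp add: add_ac)
  qed
  have "p \<notin> Z" "q \<notin> Z"
    using assms by (metis Z_commute)+
  have "p + q \<notin> Z"
  proof
    assume "p + q \<in> Z"
    then have "p * (p + q) = (p + q) * p"
      by (rule Z_commute)
    with assms show False
      by (simp add: distrib_left distrib_right)
  qed
  have "p * q \<notin> Z"
  proof
    assume "p * q \<in> Z"
    then have "p * (p * q) = p * q * p"
      by (rule Z_commute)
    moreover have "p \<noteq> 0"
      using assms by auto
    ultimately show False
      using assms by (simp add: mult.assoc)
  qed
  \<comment> \<open>Comparing the squares of \<open>p\<close>, \<open>q\<close> and \<open>p + q\<close> shows that \<open>p * q + q * p = 1\<close>.\<close>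
  have "1 + (p * q + q * p) = 0"
    using square[OF \<open>p + q \<notin> Z\<close>] square[OF \<open>p \<notin> Z\<close>] square[OF \<open>q \<notin> Z\<close>]
    by (simp add: distrib_left distrib_right add_ac)
  then have "1 = p * q + q * p"
    using double'[of 1 "p * q + q * p"] by simp
  then have qp: "q * p = 1 + p * q"
    using double'[of "p * q" "q * p"] by (simp add: add.commute)
  have "p * q + 1 = p * (q * p) * q"
    using square[OF \<open>p * q \<notin> Z\<close>] by (simp add: mult.assoc)
  also have "\<dots> = p * q + (p * p) * (q * q)"
    by (simp add: qp distrib_left distrib_right mult.assoc)
  also have "\<dots> = p * q + (p + 1) * (q + 1)"
    using square \<open>p \<notin> Z\<close> \<open>q \<notin> Z\<close> by simp
  finally have "(p + 1) * (q + 1) = 1"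
    by simp
  then have "(q + 1) * (p + 1) = 1"
    by (metis inverse_unique left_inverse mult_not_zero zero_neq_one)
  with \<open>(p + 1) * (q + 1) = 1\<close> have "(p + 1) * (q + 1) = (q + 1) * (p + 1)"
    by simp
  with assms show False
    by (simp add: distrib_left distrib_right add_ac)
qed

lemma central_combination:
  assumes "p * q \<noteq> q * p" "a \<in> Z" "b \<in> Z" "a * p + b * q \<in> Z"
  shows "a = 0" "b = 0"
proof -
  have "p * (a * p + b * q) = (a * p + b * q) * p"
    using assms(4) by (rule Z_commute)
  then have "b * (p * q) = b * (q * p)"
    using assms(2,3) by (simp add: distrib_left distrib_right mult.assoc Z_left_commute)
  with assms(1) show "b = 0" by simp
  with assms(4) have "a * p \<in> Z" by simp
  with assms(1,2) show "a = 0"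
    using Z_cancel[of a p] by (metis Z_commute)
qed

text \<open>
  The defect of additivity is central because it is a combination of traces. The second part is the
  norm of \<open>p + q\<close> minus the norms of \<open>p\<close> and \<open>q\<close>.
\<close>

lemma polar_defect:
  fixes p q defines "d \<equiv> bar (p + q) - bar p - bar q"
  shows "d \<in> Z" and "p * bar q + q * bar p + d * (p + q) \<in> Z"
proof -
  have "d = (p + q + bar (p + q)) - (p + bar p) - (q + bar q)"
    by (simp add: d_def algebra_simps)
  then show "d \<in> Z"
    by (metis Z_diff add_bar_in_Z)
  have "bar (p + q) = bar p + bar q + d"
    by (simp add: d_def)
  then have "(p + q) * bar (p + q) - p * bar p - q * bar q = p * bar q + q * bar p + d * (p + q)"
    using \<open>d \<in> Z\<close> by (simp add: distrib_left distrib_right Z_commute)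
  then show "p * bar q + q * bar p + d * (p + q) \<in> Z"
    by (metis Z_diff mult_bar_in_Z)
qed

text \<open>
  Let \<open>d\<close> be the defect of additivity at \<open>p\<close> and \<open>q\<close>, and \<open>e\<close> the one at \<open>a * p\<close> and \<open>q\<close>. The form
  \<open>p * bar q + q * bar p\<close> is homogeneous in \<open>p\<close>, so eliminating it from the two instances of
  \<open>polar_defect\<close> leaves a central combination of \<open>p\<close> and \<open>q\<close>. If these do not commute, its
  coefficients vanish: \<open>a * d = a * e\<close> and \<open>a * d = e\<close>. Since \<open>a\<close> is neither 0 nor 1, this forces
  \<open>d = 0\<close>. Unlike an argument with \<open>p + q\<close> and \<open>p - q\<close>, this works in characteristic 2.
\<close>

lemma bar_add: "bar (p + q) = bar p + bar q"
proof (cases "p * q = q * p")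
  case True
  then show ?thesis by (rule bar_add_commuting)
next
  case False
  then obtain a where a: "a \<in> Z" "a \<noteq> 0" "a \<noteq> 1"
    by (rule obtain_central_not_0_1)
  define d where "d = bar (p + q) - bar p - bar q"
  define e where "e = bar (a * p + q) - bar (a * p) - bar q"
  have d: "d \<in> Z" "p * bar q + q * bar p + d * (p + q) \<in> Z"
    unfolding d_def by (rule polar_defect)+
  have e: "e \<in> Z" "a * p * bar q + q * bar (a * p) + e * (a * p + q) \<in> Z"
    unfolding e_def by (rule polar_defect)+
  have "a * (p * bar q + q * bar p + d * (p + q)) -
      (a * p * bar q + q * bar (a * p) + e * (a * p + q)) \<in> Z"
    using a(1) d e by blast
  also have "a * (p * bar q + q * bar p + d * (p + q)) -
      (a * p * bar q + q * bar (a * p) + e * (a * p + q)) =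
      (a * d - a * e) * p + (a * d - e) * q"
    using a(1) e(1)
    by (simp add: bar_mult_Z distrib_left distrib_right left_diff_distrib mult.assoc Z_left_commute)
  finally have combination: "(a * d - a * e) * p + (a * d - e) * q \<in> Z" .
  have "a * d - a * e \<in> Z" "a * d - e \<in> Z"
    using a(1) d(1) e(1) by simp_all
  note central_combination[OF False this combination]
  then have "a * d = 1 * d"
    using a(2) by simp
  then have "d = 0"
    using a(3) by (metis mult_right_cancel)
  then show ?thesis
    by (simp add: d_def algebra_simps)
qed

text \<open>
  The product \<open>bar q * bar p\<close> satisfies the two conditions that determine the conjugate of a noncentral
  \<open>p * q\<close>: the sum is the polar form at \<open>p\<close> and \<open>bar q\<close>, the product is the product of the norms.
\<close>

lemma bar_mult: "bar (p * q) = bar q * bar p"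
proof (cases "p * q \<in> Z")
  case False
  have "p * bar (bar q) + bar q * bar p = (p + bar q) * bar (p + bar q) - p * bar p - bar q * bar (bar q)"
    by (simp only: bar_add distrib_left distrib_right) simp
  then have "p * q + bar q * bar p \<in> Z"
    by (metis Z_diff mult_bar_in_Z bar_bar)
  moreover have "p * q * (bar q * bar p) = (q * bar q) * (p * bar p)"
    by (metis Z_left_commute mult.assoc mult_bar_in_Z)
  ultimately show ?thesis
    using False by (intro bar_eqI) simp_all
next
  case True
  show ?thesis
  proof (cases "p = 0")
    case False
    define a n where "a = p * q" and "n = p * bar p"
    have an: "a \<in> Z" "n \<in> Z" "n \<noteq> 0"
      using True False by (simp_all add: a_def n_def)
    \<comment> \<open>A central \<open>p * q\<close> makes \<open>q\<close> a central multiple of \<open>bar p\<close>.\<close>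
    have "n * q = a * bar p"
      by (metis a_def an(1) n_def Z_commute mult.assoc mult_bar_commute)
    then have "n * bar q = a * p"
      using an by (metis bar_mult_Z bar_bar)
    then have "n * (bar q * bar p) = n * a"
      by (metis an(1) mult.assoc n_def Z_commute)
    with an True show ?thesis
      by (simp add: a_def)
  qed simp
qed

lemma is_conjugation_bar: "is_conjugation scale bar"
  unfolding is_conjugation_def ground_def[symmetric]
proof (intro conjI allI)
  show "Vector_Spaces.linear scale scale bar"
    unfolding Vector_Spaces.linear_iff
    using vector_space_axioms bar_add bar_mult_Z[OF Z_scale_1]
    by (metis scale_eq)
  show "bij bar"
    by (rule o_bij[of bar]) (auto simp: fun_eq_iff)
qed (simp_all add: bar_mult)

lemma qconj_eq_bar: "qconj scale = bar"
  unfolding qconj_def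
proof (rule the_equality, rule is_conjugation_bar)
  fix \<kappa> assume "is_conjugation scale \<kappa>"
  then have linear: "\<kappa> (scale a x) = scale a (\<kappa> x)" and "bij \<kappa>"
    and mult: "\<kappa> (x * y) = \<kappa> y * \<kappa> x"
    and "x + \<kappa> x \<in> Z" "x * \<kappa> x \<in> Z" for a x y
    by (simp_all add: is_conjugation_def Vector_Spaces.linear_iff)
  then have nonZ: "\<kappa> q = bar q" if "q \<notin> Z" for q
    using that by (metis bar_eqI)
  have "\<kappa> 0 = 0"
    using linear[of 0 0] by simp
  then have "\<kappa> 1 \<noteq> 0"
    using \<open>bij \<kappa>\<close> by (metis bij_pointE zero_neq_one)
  then have "\<kappa> 1 = 1"
    using mult[of 1 1] by simp
  then have "\<kappa> q = bar q" if "q \<in> Z" for q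
    using that linear[of _ 1] by (auto simp: ground_def)
  with nonZ show "\<kappa> = bar" by blast
qed

section \<open>Intertwining elements and orthogonal lines\<close>

text \<open>
  The equation \<open>i * i - t * i + n = 0\<close> for the trace \<open>t\<close> and the norm \<open>n\<close> of \<open>i\<close>, multiplied by \<open>x\<close>
  on the right.
\<close>

lemma trace_norm_identity: "i * i * x + x * (i * bar i) = i * x * (i + bar i)"
proof -
  have "i * x * (i + bar i) = i * ((i + bar i) * x)"
    by (simp only: mult.assoc Z_commute[OF add_bar_in_Z, of x])
  also have "\<dots> = i * i * x + i * bar i * x"
    by (simp add: distrib_left distrib_right mult.assoc)
  also have "i * bar i * x = x * (i * bar i)"
    by (simp only: Z_commute[OF mult_bar_in_Z])
  finally show ?thesis ..
qed

text \<open>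
  Every \<open>i * x - x * bar k\<close> is an intertwiner. If all of them were zero, \<open>x = 1\<close> would give
  \<open>bar k = i\<close>, and then \<open>i\<close> would be central.
\<close>

lemma skolem_noether:
  assumes "i \<notin> Z" "k + bar k = i + bar i" "k * bar k = i * bar i"
  obtains e where "e \<noteq> 0" "i * e = e * k"
proof -
  have "i * (i * x - x * bar k) = (i * x - x * bar k) * k" for x
  proof -
    have "i * i * x + x * (k * bar k) = i * x * (k + bar k)"
      using assms trace_norm_identity by simp
    then show ?thesis
      by (simp add: left_diff_distrib right_diff_distrib distrib_left mult.assoc
          mult_bar_commute algebra_simps)
  qed
  moreover have "\<exists>x. i * x - x * bar k \<noteq> 0"
  proof (rule ccontr)
    assume "\<not> ?thesis"
    then have zero: "i * x = x * bar k" for x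
      by simp
    from zero[of 1] have "bar k = i"
      by simp
    with zero have "i \<in> Z"
      by (simp add: Z_iff)
    with assms(1) show False ..
  qed
  ultimately show thesis
    using that by blast
qed

lemma bar_commutes: "x * q = q * x \<Longrightarrow> x * bar q = bar q * x"
proof -
  assume "x * q = q * x"
  moreover have "x * (q + bar q) = (q + bar q) * x"
    by (rule Z_commute) simp
  ultimately show ?thesis
    by (simp add: distrib_left distrib_right)
qed

lemma twist_iff: "i * p = p * bar i \<longleftrightarrow> p * i = bar i * p"
proof -
  have "p * (i + bar i) = (i + bar i) * p"
    by (rule Z_commute) simp
  then show ?thesis
    by (auto simp: distrib_left distrib_right)
qed

lemma centralizer_mult:
  assumes "x \<in> centralizer q" "y \<in> centralizer q"
  shows "x * y \<in> centralizer q"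
proof -
  have "x * q = q * x" "y * q = q * y"
    using assms by (simp_all add: centralizer_def)
  then have "x * y * q = q * (x * y)"
    by (metis mult.assoc)
  then show ?thesis
    by (simp add: centralizer_def)
qed

lemma centralizer_inverse: "x \<in> centralizer q \<Longrightarrow> inverse x \<in> centralizer q"
  by (simp add: centralizer_def mult_commute_imp_mult_inverse_commute)

lemma centralizer_mult_left:
  assumes "w \<in> centralizer q" "w \<noteq> 0"
  shows "(\<lambda>x. w * x) ` centralizer q = centralizer q"
proof (intro equalityI subsetI)
  fix p assume "p \<in> centralizer q"
  then have "inverse w * p \<in> centralizer q"
    using assms(1) by (intro centralizer_mult centralizer_inverse)
  moreover have "p = w * (inverse w * p)"
    using assms(2) by (simp flip: mult.assoc)
  ultimately show "p \<in> (\<lambda>x. w * x) ` centralizer q"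
    by (rule rev_image_eqI)
qed (use assms centralizer_mult in auto)

lemma centralizer_mult_right:
  assumes "w \<in> centralizer q" "w \<noteq> 0"
  shows "(\<lambda>x. x * w) ` centralizer q = centralizer q"
proof (intro equalityI subsetI)
  fix p assume "p \<in> centralizer q"
  then have "p * inverse w \<in> centralizer q"
    using assms(1) by (intro centralizer_mult centralizer_inverse)
  moreover have "p = p * inverse w * w"
    using assms(2) by (simp add: mult.assoc)
  ultimately show "p \<in> (\<lambda>x. x * w) ` centralizer q"
    by (rule rev_image_eqI)
qed (use assms centralizer_mult in auto)

text \<open>
  The solutions \<open>p\<close> of \<open>i * p = p * bar i\<close> form a coset of the centralizer, because the quotient of two
  solutions commutes with \<open>i\<close>. It is a left coset as well as a right coset.
\<close>

lemma twist_mult_left: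
  assumes "i * y = y * bar i" "y \<noteq> 0"
  shows "(\<lambda>x. y * x) ` centralizer i = {p. i * p = p * bar i}"
proof (intro equalityI subsetI)
  fix p assume "p \<in> (\<lambda>x. y * x) ` centralizer i"
  then obtain x where x: "p = y * x" "x * i = i * x"
    by (auto simp: centralizer_def)
  then have "x * bar i = bar i * x"
    by (intro bar_commutes)
  with x(1) assms(1) have "i * p = p * bar i"
    by (metis mult.assoc)
  then show "p \<in> {p. i * p = p * bar i}" ..
next
  fix p assume "p \<in> {p. i * p = p * bar i}"
  then have p: "p * i = bar i * p"
    by (simp add: twist_iff)
  have "y * i = bar i * y"
    using assms(1) by (simp add: twist_iff)
  moreover have yz: "p = y * (inverse y * p)"
    using assms(2) by (simp flip: mult.assoc)
  ultimately have "y * (inverse y * p * i) = y * (i * (inverse y * p))"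
    using p by (metis mult.assoc)
  then have "inverse y * p \<in> centralizer i"
    using assms(2) by (simp add: centralizer_def)
  with yz show "p \<in> (\<lambda>x. y * x) ` centralizer i"
    by (intro rev_image_eqI[of "inverse y * p"])
qed

lemma twist_mult_right:
  assumes "i * y = y * bar i" "y \<noteq> 0"
  shows "(\<lambda>x. x * y) ` centralizer i = {p. i * p = p * bar i}"
proof (intro equalityI subsetI)
  fix p assume "p \<in> (\<lambda>x. x * y) ` centralizer i"
  then obtain x where x: "p = x * y" "x * i = i * x"
    by (auto simp: centralizer_def)
  have "i * p = i * x * y"
    by (simp only: x(1) mult.assoc)
  also have "\<dots> = x * (i * y)"
    by (simp only: x(2)[symmetric] mult.assoc)
  also have "\<dots> = p * bar i"
    by (simp only: assms(1) x(1) mult.assoc)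
  finally show "p \<in> {p. i * p = p * bar i}"
    by simp
next
  fix p assume "p \<in> {p. i * p = p * bar i}"
  then have p: "i * p = p * bar i"
    by simp
  have zy: "p = p * inverse y * y"
    using assms(2) by (simp add: mult.assoc)
  have "i * (p * inverse y) * y = i * (p * inverse y * y)"
    by (simp only: mult.assoc)
  also have "\<dots> = p * inverse y * y * bar i"
    by (simp only: zy[symmetric] p)
  also have "\<dots> = p * inverse y * i * y"
    by (simp only: mult.assoc assms(1))
  finally have "i * (p * inverse y) * y = p * inverse y * i * y" .
  then have "p * inverse y \<in> centralizer i"
    using assms(2) by (simp add: centralizer_def)
  with zy show "p \<in> (\<lambda>x. x * y) ` centralizer i"
    by (intro rev_image_eqI[of "p * inverse y"])
qed

text \<open>
  This provides a nonzero solution of \<open>i * y = y * bar i\<close> for every noncentral \<open>i\<close>, in the inseparable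
  case too.
\<close>

lemma commutator_twists:
  fixes x i defines "y \<equiv> x * i - i * x"
  shows "i * y = y * bar i"
  using trace_norm_identity[of i x] unfolding y_def
  by (simp add: left_diff_distrib right_diff_distrib distrib_left mult.assoc algebra_simps)

lemma trace_commutator: "(x * i - i * x) + bar (x * i - i * x) = 0"
proof -
  define s t where "s = x + bar x" and "t = i + bar i"
  have "s \<in> Z" "t \<in> Z" and bar: "bar x = s - x" "bar i = t - i"
    by (simp_all add: s_def t_def)
  have "bar (x * i - i * x) = bar (x * i + (- 1) * (i * x))"
    by simp
  also have "\<dots> = bar i * bar x - bar x * bar i"
    by (simp only: bar_add bar_mult) simp
  finally show ?thesis
    using Z_commute[OF \<open>s \<in> Z\<close>, of i] Z_commute[OF \<open>t \<in> Z\<close>]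
    by (simp add: bar left_diff_distrib right_diff_distrib)
qed

text \<open>
  Orthogonality to \<open>1\<close> means trace zero, and together with orthogonality to \<open>i\<close> it gives
  \<open>i * p = p * bar i\<close>. Conversely, put \<open>y = x * i - i * x\<close>. For \<open>l\<close> and \<open>m\<close> in the centralizer,
  \<open>y * l * bar m\<close> is the commutator of \<open>x * l * bar m\<close> and \<open>i\<close>. The value of the form at \<open>y * l\<close> and
  \<open>m\<close> is its trace, which is 0.
\<close>

lemma perp_line_through_1:
  assumes "x * i \<noteq> i * x"
  shows "perp scale (centralizer i) = (\<lambda>l. (x * i - i * x) * l) ` centralizer i"
proof (intro equalityI subsetI)
  fix p assume "p \<in> perp scale (centralizer i)"
  then have *: "p * bar q + q * bar p = 0" if "q \<in> centralizer i" for q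
    using that by (simp add: perp_def qform_def qconj_eq_bar)
  have "p + bar p = 0"
    using *[of 1] by (simp add: centralizer_def)
  then have "bar p = - p"
    by (simp add: add_eq_0_iff)
  moreover have "p * bar i + i * bar p = 0"
    using *[of i] by (simp add: centralizer_def)
  ultimately have "i * p = p * bar i"
    by simp
  then show "p \<in> (\<lambda>l. (x * i - i * x) * l) ` centralizer i"
    using twist_mult_left[OF commutator_twists] assms by simp
next
  fix p assume "p \<in> (\<lambda>l. (x * i - i * x) * l) ` centralizer i"
  then obtain l where l: "p = (x * i - i * x) * l" "l * i = i * l"
    by (auto simp: centralizer_def)
  have "p * bar m + m * bar p = 0" if "m \<in> centralizer i" for m
  proof -
    have "i * m = m * i"
      using that by (simp add: centralizer_def)
    then have "i * bar m = bar m * i"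
      by (rule bar_commutes)
    then have "l * bar m * i = i * (l * bar m)"
      using l(2) by (metis mult.assoc)
    then have "p * bar m = x * (l * bar m) * i - i * (x * (l * bar m))"
      by (simp add: l(1) left_diff_distrib mult.assoc)
    moreover have "m * bar p = bar (p * bar m)"
      by (simp add: bar_mult)
    ultimately show ?thesis
      using trace_commutator[of "x * (l * bar m)" i] by simp
  qed
  then show "p \<in> perp scale (centralizer i)"
    by (simp add: perp_def qform_def qconj_eq_bar)
qed

text \<open>
  Left multiplication by \<open>c\<close> multiplies the form by the norm of \<open>c\<close>.
\<close>

lemma perp_mult_left:
  assumes "c \<noteq> 0"
  shows "perp scale ((\<lambda>x. c * x) ` X) = (\<lambda>x. c * x) ` perp scale X"
proof -
  have qform: "qform scale (c * p) (c * q) = c * qform scale p q * bar c" for p q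
    by (simp add: qform_def qconj_eq_bar bar_mult distrib_left distrib_right mult.assoc)
  have mem: "c * p \<in> perp scale ((\<lambda>x. c * x) ` X) \<longleftrightarrow> p \<in> perp scale X" for p
    using assms by (simp add: perp_def qform)
  have "p \<in> (\<lambda>x. c * x) ` perp scale X" if "p \<in> perp scale ((\<lambda>x. c * x) ` X)" for p
  proof
    show "p = c * (inverse c * p)"
      using assms by (simp flip: mult.assoc)
    with that show "inverse c * p \<in> perp scale X"
      by (simp flip: mem)
  qed
  then show ?thesis
    using mem by auto
qed

section \<open>Parallel classes\<close>

lemma line_nonzero:
  assumes "M \<in> lines scale" obtains m where "m \<in> M" "m \<noteq> 0"
proof -
  have "\<not> M \<subseteq> span {}"
    using dim_le_card[of M "{}"] assms by (auto simp: lines_def)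
  then show thesis
    using that by auto
qed

lemma Z_subset_line:
  assumes "L \<in> lines scale" "1 \<in> L" shows "Z \<subseteq> L"
  using assms subspace_scale[of L 1] by (auto simp: lines_def ground_def)

text \<open>
  A line through \<open>F1\<close> is a field.
\<close>

lemma line_through_1_mult:
  assumes "L \<in> lines scale" "1 \<in> L" "w \<in> L" "w \<noteq> 0"
  shows "(\<lambda>x. w * x) ` L = L" "(\<lambda>x. x * w) ` L = L"
proof -
  obtain q where "L = centralizer q"
    using assms(1,2) by (rule line_through_1_obtain)
  with assms(3,4) show "(\<lambda>x. w * x) ` L = L" "(\<lambda>x. x * w) ` L = L"
    by (simp_all add: centralizer_mult_left centralizer_mult_right)
qed

lemma left_parallel_iff:
  "(M, N) \<in> left_parallel scale \<longleftrightarrow>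
    M \<in> lines scale \<and> (\<exists>c. c \<noteq> 0 \<and> N = (\<lambda>x. c * x) ` M)"
  by (auto simp: left_parallel_def intro: lines_mult_left)

lemma right_parallel_iff:
  "(M, N) \<in> right_parallel scale \<longleftrightarrow>
    M \<in> lines scale \<and> (\<exists>d. d \<noteq> 0 \<and> N = (\<lambda>x. x * d) ` M)"
  by (auto simp: right_parallel_def intro: lines_mult_right)

text \<open>
  Dividing \<open>M\<close> by one of its nonzero elements \<open>m\<close> gives such a line. For uniqueness, write
  \<open>M = c N\<close> and \<open>m = c * n\<close>; then \<open>m\<inverse> M = n\<inverse> N = N\<close>, as \<open>N\<close> is a field.
\<close>

lemma unique_left_parallel_through_1:
  assumes "M \<in> lines scale"
  shows "\<exists>!L. L \<in> lines scale \<and> Z \<subseteq> L \<and> (L, M) \<in> left_parallel scale"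
proof -
  obtain m where m: "m \<in> M" "m \<noteq> 0"
    using assms by (rule line_nonzero)
  define L where "L = (\<lambda>x. inverse m * x) ` M"
  have L: "L \<in> lines scale" and "1 \<in> L"
    using m assms by (auto simp: L_def lines_mult_left image_iff intro: bexI[of _ m])
  moreover have "(\<lambda>x. m * x) ` L = M"
    using m by (simp add: L_def image_mult_left_mult_left)
  ultimately have LM: "L \<in> lines scale" "Z \<subseteq> L" "(L, M) \<in> left_parallel scale"
    using m by (auto simp: left_parallel_iff Z_subset_line)
  have "N = L" if N: "N \<in> lines scale" "Z \<subseteq> N" "(N, M) \<in> left_parallel scale" for N
  proof -
    obtain c where c: "c \<noteq> 0" "M = (\<lambda>x. c * x) ` N"
      using N(3) by (auto simp: left_parallel_iff)
    have "1 \<in> N"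
      using N(2) Z_1 by (rule subsetD)
    obtain n where n: "n \<in> N" "m = c * n"
      using m(1) c(2) by auto
    then have "n \<noteq> 0"
      using m(2) by auto
    have "inverse m * c = inverse n"
      using c(1) \<open>n \<noteq> 0\<close> by (simp add: n(2) nonzero_inverse_mult_distrib mult.assoc)
    then have "L = (\<lambda>x. inverse n * x) ` N"
      by (simp add: L_def c(2) image_mult_left_mult_left)
    moreover have "(\<lambda>x. n * x) ` N = N"
      using N(1) \<open>1 \<in> N\<close> n(1) \<open>n \<noteq> 0\<close> by (rule line_through_1_mult)
    ultimately show "N = L"
      using \<open>n \<noteq> 0\<close> by (metis image_mult_left_eq_iff)
  qed
  then show ?thesis
    by (intro ex1I[of _ L]) (simp_all add: LM)
qed

lemma unique_right_parallel_through_1: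
  assumes "M \<in> lines scale"
  shows "\<exists>!L. L \<in> lines scale \<and> Z \<subseteq> L \<and> (L, M) \<in> right_parallel scale"
proof -
  obtain m where m: "m \<in> M" "m \<noteq> 0"
    using assms by (rule line_nonzero)
  define L where "L = (\<lambda>x. x * inverse m) ` M"
  have L: "L \<in> lines scale" and "1 \<in> L"
    using m assms by (auto simp: L_def lines_mult_right image_iff intro: bexI[of _ m])
  moreover have "(\<lambda>x. x * m) ` L = M"
    using m by (simp add: L_def image_mult_right_mult_right)
  ultimately have LM: "L \<in> lines scale" "Z \<subseteq> L" "(L, M) \<in> right_parallel scale"
    using m by (auto simp: right_parallel_iff Z_subset_line)
  have "N = L" if N: "N \<in> lines scale" "Z \<subseteq> N" "(N, M) \<in> right_parallel scale" for N
  proof -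
    obtain c where c: "c \<noteq> 0" "M = (\<lambda>x. x * c) ` N"
      using N(3) by (auto simp: right_parallel_iff)
    have "1 \<in> N"
      using N(2) Z_1 by (rule subsetD)
    obtain n where n: "n \<in> N" "m = n * c"
      using m(1) c(2) by auto
    then have "n \<noteq> 0"
      using m(2) by auto
    have "c * inverse m = inverse n"
      using c(1) \<open>n \<noteq> 0\<close> by (simp add: n(2) nonzero_inverse_mult_distrib flip: mult.assoc)
    then have "L = (\<lambda>x. x * inverse n) ` N"
      by (simp add: L_def c(2) image_mult_right_mult_right)
    moreover have "(\<lambda>x. x * n) ` N = N"
      using N(1) \<open>1 \<in> N\<close> n(1) \<open>n \<noteq> 0\<close> by (rule line_through_1_mult)
    ultimately show "N = L"
      using \<open>n \<noteq> 0\<close> by (metis image_mult_right_eq_iff)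
  qed
  then show ?thesis
    by (intro ex1I[of _ L]) (simp_all add: LM)
qed

lemma left_class_eq:
  assumes "(L, M) \<in> left_parallel scale"
  shows "left_class scale M = {N. \<exists>u. u \<noteq> 0 \<and> N = (\<lambda>x. u * x) ` L}"
proof -
  obtain g where L: "L \<in> lines scale" and g: "g \<noteq> 0" "M = (\<lambda>x. g * x) ` L"
    using assms by (auto simp: left_parallel_iff)
  have "N \<in> left_class scale M \<longleftrightarrow> (\<exists>c. c \<noteq> 0 \<and> N = (\<lambda>x. (c * g) * x) ` L)" for N
    using L g by (simp add: left_class_def left_parallel_iff lines_mult_left image_mult_left_mult_left)
  also have "\<dots> N \<longleftrightarrow> (\<exists>u. u \<noteq> 0 \<and> N = (\<lambda>x. u * x) ` L)" for N
  proof
    assume "\<exists>c. c \<noteq> 0 \<and> N = (\<lambda>x. (c * g) * x) ` L"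
    then obtain c where "c \<noteq> 0" "N = (\<lambda>x. (c * g) * x) ` L" by blast
    with g(1) show "\<exists>u. u \<noteq> 0 \<and> N = (\<lambda>x. u * x) ` L"
      by (intro exI[of _ "c * g"]) simp
  next
    assume "\<exists>u. u \<noteq> 0 \<and> N = (\<lambda>x. u * x) ` L"
    then obtain u where "u \<noteq> 0" "N = (\<lambda>x. u * x) ` L" by blast
    with g(1) show "\<exists>c. c \<noteq> 0 \<and> N = (\<lambda>x. (c * g) * x) ` L"
      by (intro exI[of _ "u * inverse g"]) (simp add: mult.assoc)
  qed
  finally show ?thesis
    by (intro set_eqI) (simp only: mem_Collect_eq)
qed

lemma right_class_eq:
  assumes "(L, M) \<in> right_parallel scale"
  shows "right_class scale M = {N. \<exists>u. u \<noteq> 0 \<and> N = (\<lambda>x. x * u) ` L}"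
proof -
  obtain g where L: "L \<in> lines scale" and g: "g \<noteq> 0" "M = (\<lambda>x. x * g) ` L"
    using assms by (auto simp: right_parallel_iff)
  have "N \<in> right_class scale M \<longleftrightarrow> (\<exists>c. c \<noteq> 0 \<and> N = (\<lambda>x. x * (g * c)) ` L)" for N
    using L g
    by (simp add: right_class_def right_parallel_iff lines_mult_right image_mult_right_mult_right)
  also have "\<dots> N \<longleftrightarrow> (\<exists>u. u \<noteq> 0 \<and> N = (\<lambda>x. x * u) ` L)" for N
  proof
    assume "\<exists>c. c \<noteq> 0 \<and> N = (\<lambda>x. x * (g * c)) ` L"
    then obtain c where "c \<noteq> 0" "N = (\<lambda>x. x * (g * c)) ` L" by blast
    with g(1) show "\<exists>u. u \<noteq> 0 \<and> N = (\<lambda>x. x * u) ` L"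
      by (intro exI[of _ "g * c"]) simp
  next
    assume "\<exists>u. u \<noteq> 0 \<and> N = (\<lambda>x. x * u) ` L"
    then obtain u where "u \<noteq> 0" "N = (\<lambda>x. x * u) ` L" by blast
    with g(1) show "\<exists>c. c \<noteq> 0 \<and> N = (\<lambda>x. x * (g * c)) ` L"
      by (intro exI[of _ "inverse g * u"]) (simp flip: mult.assoc)
  qed
  finally show ?thesis
    by (intro set_eqI) (simp only: mem_Collect_eq)
qed

text \<open>
  The factors of a common member \<open>u L1 = L2 v\<close> can be chosen equal: \<open>1 \<in> L1\<close> gives \<open>u = l * v\<close> with
  \<open>l \<in> L2\<close>, and the field \<open>L2\<close> absorbs \<open>l\<close>.
\<close>

lemma class_inter_eq:
  assumes "(L1, M1) \<in> left_parallel scale" "(L2, M2) \<in> right_parallel scale" "1 \<in> L1" "1 \<in> L2"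
  shows "left_class scale M1 \<inter> right_class scale M2 =
    {(\<lambda>x. u * x) ` L1 |u. u \<noteq> 0 \<and> (\<lambda>x. u * x) ` L1 = (\<lambda>x. x * u) ` L2}"
proof -
  have L2: "L2 \<in> lines scale"
    using assms(2) by (simp add: right_parallel_iff)
  have same: "(\<lambda>x. u * x) ` L1 = (\<lambda>x. x * u) ` L2"
    if "u \<noteq> 0" "v \<noteq> 0" and eq: "(\<lambda>x. u * x) ` L1 = (\<lambda>x. x * v) ` L2" for u v
  proof -
    have "u \<in> (\<lambda>x. x * v) ` L2"
      unfolding eq[symmetric] using assms(3) by (intro image_eqI[of _ _ 1]) simp_all
    then obtain l where l: "l \<in> L2" "u = l * v"
      by auto
    have "(\<lambda>x. x * u) ` L2 = (\<lambda>x. x * v) ` (\<lambda>x. x * l) ` L2"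
      by (simp add: l(2) image_mult_right_mult_right)
    also have "(\<lambda>x. x * l) ` L2 = L2"
      using L2 assms(4) l that(1) by (intro line_through_1_mult) auto
    finally show ?thesis
      using eq by simp
  qed
  show ?thesis
    unfolding left_class_eq[OF assms(1)] right_class_eq[OF assms(2)]
  proof (intro set_eqI iffI)
    fix N assume "N \<in> {N. \<exists>u. u \<noteq> 0 \<and> N = (\<lambda>x. u * x) ` L1} \<inter> {N. \<exists>v. v \<noteq> 0 \<and> N = (\<lambda>x. x * v) ` L2}"
    then obtain u v where uv: "u \<noteq> 0" "v \<noteq> 0" "N = (\<lambda>x. u * x) ` L1" "N = (\<lambda>x. x * v) ` L2"
      by (elim IntE CollectE exE conjE)
    then have "(\<lambda>x. u * x) ` L1 = (\<lambda>x. x * u) ` L2"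
      using same[of u v] by simp
    with uv(1,3) show "N \<in> {(\<lambda>x. u * x) ` L1 |u. u \<noteq> 0 \<and> (\<lambda>x. u * x) ` L1 = (\<lambda>x. x * u) ` L2}"
      by (intro CollectI exI[of _ u] conjI)
  next
    fix N assume "N \<in> {(\<lambda>x. u * x) ` L1 |u. u \<noteq> 0 \<and> (\<lambda>x. u * x) ` L1 = (\<lambda>x. x * u) ` L2}"
    then obtain u where u: "N = (\<lambda>x. u * x) ` L1" "u \<noteq> 0" "(\<lambda>x. u * x) ` L1 = (\<lambda>x. x * u) ` L2"
      by (elim CollectE exE conjE)
    then have "N = (\<lambda>x. x * u) ` L2"
      by simp
    with u(1,2) show "N \<in> {N. \<exists>u. u \<noteq> 0 \<and> N = (\<lambda>x. u * x) ` L1} \<inter> {N. \<exists>v. v \<noteq> 0 \<and> N = (\<lambda>x. x * v) ` L2}"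
      by (intro IntI CollectI exI[of _ u] conjI)
  qed
qed

text \<open>
  The conjugate \<open>j\<close> of \<open>i\<close> by \<open>w\<close> has the same quadratic equation as \<open>i\<close> and commutes with \<open>i\<close>. So
  \<open>(j - i) * (j - bar i)\<close> is that equation evaluated at \<open>j\<close>.
\<close>

lemma normalizer_centralizer:
  assumes "w \<noteq> 0" and norm: "(\<lambda>x. w * x) ` centralizer i = (\<lambda>x. x * w) ` centralizer i"
  shows "w \<in> centralizer i \<or> i * w = w * bar i"
proof -
  have "w * i \<in> (\<lambda>x. x * w) ` centralizer i"
    unfolding norm[symmetric] by (intro image_eqI[of _ _ i]) (simp_all add: centralizer_def)
  then obtain j where j: "w * i = j * w" "j * i = i * j"
    by (auto simp: centralizer_def)
  have square: "i * i + i * bar i = (i + bar i) * i"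
    by (simp add: distrib_right mult_bar_commute)
  have "(j * j + i * bar i) * w = w * (i * i + i * bar i)"
  proof -
    have "j * j * w = w * (i * i)"
      by (metis j(1) mult.assoc)
    moreover have "w * (i * bar i) = i * bar i * w"
      by (rule Z_commute) simp
    ultimately show ?thesis
      by (simp only: distrib_left distrib_right)
  qed
  also have "\<dots> = (i + bar i) * (w * i)"
    unfolding square by (rule Z_left_commute) simp
  also have "\<dots> = (i + bar i) * j * w"
    by (simp only: j(1) mult.assoc)
  also have "(i + bar i) * j = j * (i + bar i)"
    by (rule Z_commute[symmetric]) simp
  finally have "j * j + i * bar i = j * (i + bar i)"
    using assms(1) by simp
  then have "(j - i) * (j - bar i) = 0"
    using j(2) by (simp add: left_diff_distrib right_diff_distrib distrib_left)
      (simp add: algebra_simps)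
  then have "j = i \<or> j = bar i"
    by simp
  then show ?thesis
    using j(1) by (auto simp: centralizer_def twist_iff)
qed

text \<open>
  One solution \<open>e\<close> gives the two solutions \<open>e\<close> and \<open>e * y\<close>, where \<open>y\<close> is a commutator with \<open>i\<close>. Every
  solution is \<open>e * w\<close> for some \<open>w\<close> that normalizes the centralizer, so that \<open>w\<close> carries the centralizer to
  itself or to its orthogonal line.
\<close>

lemma class_inter_pair:
  assumes "i \<notin> Z" "e \<noteq> 0" and e: "(\<lambda>x. e * x) ` centralizer i = (\<lambda>x. x * e) ` L"
  shows "{(\<lambda>x. u * x) ` centralizer i |u. u \<noteq> 0 \<and> (\<lambda>x. u * x) ` centralizer i = (\<lambda>x. x * u) ` L} =
    {(\<lambda>x. e * x) ` centralizer i, perp scale ((\<lambda>x. e * x) ` centralizer i)}"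
proof -
  let ?C = "centralizer i"
  define T where "T = {p. i * p = p * bar i}"
  obtain x where x: "x * i \<noteq> i * x"
    using assms(1) by (metis Z_iff)
  define y where "y = x * i - i * x"
  have "y \<noteq> 0" and y: "i * y = y * bar i"
    using x commutator_twists by (simp_all add: y_def)
  have yC: "(\<lambda>x. y * x) ` ?C = T" and Cy: "(\<lambda>x. x * y) ` ?C = T"
    unfolding T_def using twist_mult_left[OF y] twist_mult_right[OF y] \<open>y \<noteq> 0\<close> by simp_all
  have "perp scale ?C = T"
    using perp_line_through_1[OF x] yC by (simp add: y_def)
  then have perp: "perp scale ((\<lambda>x. e * x) ` ?C) = (\<lambda>x. e * x) ` T"
    using perp_mult_left[OF assms(2)] by simp
  have "(\<lambda>x. (e * y) * x) ` ?C = (\<lambda>x. e * x) ` T"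
    by (simp only: image_mult_left_mult_left[symmetric] yC)
  moreover have "(\<lambda>x. e * x) ` T = (\<lambda>x. x * (e * y)) ` L"
    by (simp only: Cy[symmetric] image_mult_left_mult_right e image_mult_right_mult_right)
  ultimately have ey: "\<exists>u. (\<lambda>x. e * x) ` T = (\<lambda>x. u * x) ` ?C \<and> u \<noteq> 0 \<and>
      (\<lambda>x. u * x) ` ?C = (\<lambda>x. x * u) ` L"
    using assms(2) \<open>y \<noteq> 0\<close> by (intro exI[of _ "e * y"]) simp
  have only: "(\<lambda>x. u * x) ` ?C = (\<lambda>x. e * x) ` ?C \<or> (\<lambda>x. u * x) ` ?C = (\<lambda>x. e * x) ` T"
    if u: "u \<noteq> 0" "(\<lambda>x. u * x) ` ?C = (\<lambda>x. x * u) ` L" for u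
  proof -
    define w where "w = inverse e * u"
    have "w \<noteq> 0" and uw: "u = e * w"
      using assms(2) u(1) by (simp_all add: w_def flip: mult.assoc)
    have "(\<lambda>x. e * x) ` (\<lambda>x. w * x) ` ?C = (\<lambda>x. x * w) ` (\<lambda>x. x * e) ` L"
      using u(2) by (simp only: uw image_mult_left_mult_left image_mult_right_mult_right)
    also have "\<dots> = (\<lambda>x. e * x) ` (\<lambda>x. x * w) ` ?C"
      by (simp only: e[symmetric] image_mult_left_mult_right)
    finally have "(\<lambda>x. w * x) ` ?C = (\<lambda>x. x * w) ` ?C"
      using assms(2) by (simp add: inj_image_eq_iff inj_def)
    from normalizer_centralizer[OF \<open>w \<noteq> 0\<close> this]
    have "(\<lambda>x. w * x) ` ?C = ?C \<or> (\<lambda>x. w * x) ` ?C = T"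
      unfolding T_def using centralizer_mult_left[of w i] twist_mult_left[of i w] \<open>w \<noteq> 0\<close> by auto
    then show ?thesis
      unfolding uw image_mult_left_mult_left[symmetric] by auto
  qed
  show ?thesis
    unfolding perp
  proof (intro equalityI subsetI)
    fix N assume "N \<in> {(\<lambda>x. e * x) ` ?C, (\<lambda>x. e * x) ` T}"
    then consider "N = (\<lambda>x. e * x) ` ?C" | "N = (\<lambda>x. e * x) ` T"
      by auto
    then show "N \<in> {(\<lambda>x. u * x) ` ?C |u. u \<noteq> 0 \<and> (\<lambda>x. u * x) ` ?C = (\<lambda>x. x * u) ` L}"
    proof cases
      case 1
      then show ?thesis
        unfolding mem_Collect_eq using assms(2) e by (intro exI[of _ e]) simp
    next
      case 2
      then show ?thesis
        unfolding mem_Collect_eq using ey by simp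
    qed
  next
    fix N assume "N \<in> {(\<lambda>x. u * x) ` ?C |u. u \<noteq> 0 \<and> (\<lambda>x. u * x) ` ?C = (\<lambda>x. x * u) ` L}"
    then obtain u where "N = (\<lambda>x. u * x) ` ?C" "u \<noteq> 0" "(\<lambda>x. u * x) ` ?C = (\<lambda>x. x * u) ` L"
      by (elim CollectE exE conjE)
    then show "N \<in> {(\<lambda>x. e * x) ` ?C, (\<lambda>x. e * x) ` T}"
      using only[of u] by simp
  qed
qed

text \<open>
  The relation on the right contains both parallelisms. It is an equivalence relation because left and
  right multiplications commute, and each of its pairs is composed of a left and a right parallel pair.
\<close>

lemma pi_lr_iff:
  "(M, N) \<in> pi_lr scale \<longleftrightarrow>
    M \<in> lines scale \<and> (\<exists>a b. a \<noteq> 0 \<and> b \<noteq> 0 \<and> N = (\<lambda>x. x * b) ` (\<lambda>x. a * x) ` M)"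
proof -
  define R where "R = {(M, N). M \<in> lines scale \<and>
    (\<exists>a b. a \<noteq> 0 \<and> b \<noteq> 0 \<and> N = (\<lambda>x. x * b) ` (\<lambda>x. a * x) ` M)}"
  have R_I: "(M, N) \<in> R"
    if "M \<in> lines scale" "a \<noteq> 0" "b \<noteq> 0" "N = (\<lambda>x. x * b) ` (\<lambda>x. a * x) ` M" for M N a b
    unfolding R_def using that by blast
  have "equiv (lines scale) R"
  proof (rule equivI)
    show "R \<subseteq> lines scale \<times> lines scale"
      by (auto simp: R_def intro!: lines_mult_left lines_mult_right)
    show "refl_on (lines scale) R"
      by (rule refl_onI) (rule R_I[of _ 1 1], simp_all)
    show "sym R"
    proof (rule symI)
      fix M N assume "(M, N) \<in> R"
      then obtain a b where M: "M \<in> lines scale" and ab: "a \<noteq> 0" "b \<noteq> 0"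
        and N: "N = (\<lambda>x. x * b) ` (\<lambda>x. a * x) ` M"
        by (auto simp: R_def)
      have "M = (\<lambda>x. x * inverse b) ` (\<lambda>x. inverse a * x) ` N"
        using ab by (simp add: N image_mult_left_mult_right image_mult_left_mult_left
            image_mult_right_mult_right)
      moreover have "N \<in> lines scale"
        using M ab by (simp add: N lines_mult_left lines_mult_right)
      ultimately show "(N, M) \<in> R"
        using ab by (intro R_I[of N "inverse a" "inverse b"]) simp_all
    qed
    show "trans R"
    proof (rule transI)
      fix M N K assume "(M, N) \<in> R" "(N, K) \<in> R"
      then obtain a b c d where M: "M \<in> lines scale" and nz: "a \<noteq> 0" "b \<noteq> 0" "c \<noteq> 0" "d \<noteq> 0"
        and N: "N = (\<lambda>x. x * b) ` (\<lambda>x. a * x) ` M"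
        and K: "K = (\<lambda>x. x * d) ` (\<lambda>x. c * x) ` N"
        by (auto simp: R_def)
      have "K = (\<lambda>x. x * (b * d)) ` (\<lambda>x. (c * a) * x) ` M"
        by (simp add: K N image_mult_left_mult_right image_mult_left_mult_left
            image_mult_right_mult_right)
      with M nz show "(M, K) \<in> R"
        by (intro R_I[of M "c * a" "b * d"]) simp_all
    qed
  qed
  moreover have "left_parallel scale \<subseteq> R"
  proof (rule subrelI)
    fix M N assume "(M, N) \<in> left_parallel scale"
    then obtain c where "M \<in> lines scale" "c \<noteq> 0" "N = (\<lambda>x. c * x) ` M"
      by (auto simp: left_parallel_iff)
    then show "(M, N) \<in> R"
      by (intro R_I[of M c 1]) simp_all
  qed
  moreover have "right_parallel scale \<subseteq> R"
  proof (rule subrelI)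
    fix M N assume "(M, N) \<in> right_parallel scale"
    then obtain c where "M \<in> lines scale" "c \<noteq> 0" "N = (\<lambda>x. x * c) ` M"
      by (auto simp: right_parallel_iff)
    then show "(M, N) \<in> R"
      by (intro R_I[of M 1 c]) simp_all
  qed
  ultimately have "pi_lr scale \<subseteq> R"
    unfolding pi_lr_def by blast
  moreover have "R \<subseteq> pi_lr scale"
  proof (rule subrelI)
    fix M N assume "(M, N) \<in> R"
    then obtain a b where M: "M \<in> lines scale" and ab: "a \<noteq> 0" "b \<noteq> 0"
      and N: "N = (\<lambda>x. x * b) ` (\<lambda>x. a * x) ` M"
      by (auto simp: R_def)
    define K where "K = (\<lambda>x. a * x) ` M"
    have MK: "(M, K) \<in> left_parallel scale"
      unfolding left_parallel_iff K_def using M ab(1) by auto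
    have KN: "(K, N) \<in> right_parallel scale"
      unfolding right_parallel_iff N K_def using lines_mult_left[OF ab(1) M] ab(2) by auto
    have "(M, N) \<in> S"
      if "equiv (lines scale) S" "left_parallel scale \<subseteq> S" "right_parallel scale \<subseteq> S" for S
      using that(1) subsetD[OF that(2) MK] subsetD[OF that(3) KN]
      by (auto elim: equivE dest: transD)
    then show "(M, N) \<in> pi_lr scale"
      unfolding pi_lr_def by simp
  qed
  ultimately have "pi_lr scale = R" ..
  then show ?thesis
    by (simp add: R_def)
qed

section \<open>Isomorphic and conjugate subfields\<close>

lemma F_isomorphic_conjugate:
  assumes "e \<noteq> 0" "(\<lambda>x. inverse e * x * e) ` L1 = L2"
  shows "F_isomorphic scale L1 L2"
  unfolding F_isomorphic_def
proof (intro exI conjI ballI)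
  show "bij_betw (\<lambda>x. inverse e * x * e) L1 L2"
    using assms by (simp add: bij_betw_def inj_on_def)
  fix x y
  show "inverse e * (x + y) * e = inverse e * x * e + inverse e * y * e"
    by (simp add: distrib_left distrib_right)
  have "inverse e * x * e * (inverse e * y * e) = inverse e * x * (e * inverse e) * y * e"
    by (simp only: mult.assoc)
  also have "\<dots> = inverse e * (x * y) * e"
    by (simp only: right_inverse[OF assms(1)] mult_1_right mult.assoc)
  finally show "inverse e * (x * y) * e = inverse e * x * e * (inverse e * y * e)" ..
next
  fix a assume "a \<in> Z"
  then have "inverse e * a * e = a * (inverse e * e)"
    by (simp only: Z_commute mult.assoc)
  then show "inverse e * a * e = a"
    using assms(1) by simp
qed

text \<open>
  An isomorphism preserves the quadratic equation of a generator, and elements with the same equation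
  are conjugate by \<open>skolem_noether\<close>.
\<close>

lemma F_isomorphic_imp_conjugate:
  assumes lines: "L1 \<in> lines scale" "1 \<in> L1" "L2 \<in> lines scale" "1 \<in> L2"
    and iso: "F_isomorphic scale L1 L2"
  shows "\<exists>e. e \<noteq> 0 \<and> (\<lambda>x. inverse e * x * e) ` L1 = L2"
proof -
  obtain \<phi> where bij: "bij_betw \<phi> L1 L2"
    and hom: "\<And>x y. x \<in> L1 \<Longrightarrow> y \<in> L1 \<Longrightarrow> \<phi> (x + y) = \<phi> x + \<phi> y"
      "\<And>x y. x \<in> L1 \<Longrightarrow> y \<in> L1 \<Longrightarrow> \<phi> (x * y) = \<phi> x * \<phi> y"
    and fix_Z: "\<And>a. a \<in> Z \<Longrightarrow> \<phi> a = a"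
    using iso by (auto simp: F_isomorphic_def)
  obtain i where i: "i \<notin> Z" "i \<in> L1" "L1 = centralizer i"
    using lines(1,2) by (rule line_through_1_obtain)
  define k where "k = \<phi> i"
  have Z_L1: "Z \<subseteq> L1"
    using lines(1,2) by (rule Z_subset_line)
  have "k \<in> L2"
    using bij i(2) by (auto simp: k_def bij_betw_def)
  have "k \<notin> Z"
  proof
    assume "k \<in> Z"
    then have "\<phi> k = \<phi> i" "k \<in> L1"
      using fix_Z Z_L1 by (auto simp: k_def)
    then have "k = i"
      using bij i(2) by (auto simp: bij_betw_def inj_on_def)
    with \<open>k \<in> Z\<close> i(1) show False by simp
  qed
  have L2: "L2 = centralizer k"
    using centralizer_line(3)[OF \<open>k \<notin> Z\<close>] lines \<open>k \<in> L2\<close> by simp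
  define t n where "t = i + bar i" and "n = i * bar i"
  have tn: "t \<in> Z" "n \<in> Z"
    by (simp_all add: t_def n_def)
  have "i * i + n = t * i"
    by (simp add: t_def n_def distrib_right mult_bar_commute)
  moreover have "t \<in> L1" "n \<in> L1" "i * i \<in> L1"
    using tn Z_L1 i by (auto intro: centralizer_mult)
  ultimately have "k * k + n = t * k"
    using hom i(2) fix_Z tn unfolding k_def by metis
  then have kk: "k * (t - k) = n"
    using Z_commute[OF tn(1), of k] by (simp add: algebra_simps)
  then have "bar k = t - k"
    using \<open>k \<notin> Z\<close> tn by (intro bar_eqI) simp_all
  with kk have "k + bar k = i + bar i" "k * bar k = i * bar i"
    by (simp_all add: t_def n_def)
  then obtain e where e: "e \<noteq> 0" "i * e = e * k"
    using skolem_noether[OF i(1)] by blast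
  have "(\<lambda>x. inverse e * x * e) ` L1 = L2"
  proof (intro equalityI subsetI)
    fix p assume "p \<in> (\<lambda>x. inverse e * x * e) ` L1"
    then obtain a b where ab: "p = inverse e * (a + b * i) * e" "a \<in> Z" "b \<in> Z"
      unfolding i(3) centralizer_line(2)[OF i(1)] by auto
    have "p = inverse e * (e * (a + b * k))"
      using ab(2,3) by (simp add: ab(1) distrib_left distrib_right mult.assoc e(2) Z_comm)
    then have "p = a + b * k"
      using e(1) by (simp flip: mult.assoc)
    with ab(2,3) show "p \<in> L2"
      unfolding L2 centralizer_line(2)[OF \<open>k \<notin> Z\<close>] by auto
  next
    fix p assume "p \<in> L2"
    then obtain a b where ab: "p = a + b * k" "a \<in> Z" "b \<in> Z"
      unfolding L2 centralizer_line(2)[OF \<open>k \<notin> Z\<close>] by auto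
    have "inverse e * (a + b * i) * e = inverse e * (e * (a + b * k))"
      using ab(2,3) by (simp add: distrib_left distrib_right mult.assoc e(2) Z_comm)
    then have "p = inverse e * (a + b * i) * e"
      using e(1) ab(1) by (simp flip: mult.assoc)
    moreover have "a + b * i \<in> L1"
      unfolding i(3) centralizer_line(2)[OF i(1)] using ab(2,3) by auto
    ultimately show "p \<in> (\<lambda>x. inverse e * x * e) ` L1"
      by (rule image_eqI)
  qed
  with e(1) show ?thesis by blast
qed

end

section \<open>Lines related by the two parallelisms\<close>

theorem theorem4p2:
  fixes scale :: "'f::field \<Rightarrow> 'h::division_ring \<Rightarrow> 'h"
    and M1 M2 L1 L2 :: "'h set"
  assumes "quaternion_skew_field scale"
    and "M1 \<in> lines scale" and "M2 \<in> lines scale"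
    and "L1 = (THE L. L \<in> lines scale \<and> ground scale \<subseteq> L \<and> (L, M1) \<in> left_parallel scale)"
    and "L2 = (THE L. L \<in> lines scale \<and> ground scale \<subseteq> L \<and> (L, M2) \<in> right_parallel scale)"
  shows
    "((M1, M2) \<in> pi_lr scale
       \<longleftrightarrow> (\<exists>e1 e2. e1 \<noteq> 0 \<and> e2 \<noteq> 0 \<and> (\<lambda>x. e1 * x) ` M1 = (\<lambda>x. x * e2) ` M2)) \<and>
     ((M1, M2) \<in> pi_lr scale
       \<longleftrightarrow> left_class scale M1 \<inter> right_class scale M2 \<noteq> {}) \<and>
     ((M1, M2) \<in> pi_lr scale
       \<longleftrightarrow> (\<exists>M\<in>lines scale. left_class scale M1 \<inter> right_class scale M2 = {M, perp scale M})) \<and>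
     ((M1, M2) \<in> pi_lr scale \<longleftrightarrow> F_isomorphic scale L1 L2) \<and>
     ((M1, M2) \<in> pi_lr scale
       \<longleftrightarrow> (\<exists>e. e \<noteq> 0 \<and> (\<lambda>x. inverse e * x * e) ` L1 = L2))"
proof -
  interpret quaternion_skew_field scale by fact
  have L1: "L1 \<in> lines scale" "Z \<subseteq> L1" "(L1, M1) \<in> left_parallel scale"
    using theI'[OF unique_left_parallel_through_1[OF assms(2)]] unfolding assms(4) by simp_all
  have L2: "L2 \<in> lines scale" "Z \<subseteq> L2" "(L2, M2) \<in> right_parallel scale"
    using theI'[OF unique_right_parallel_through_1[OF assms(3)]] unfolding assms(5) by simp_all
  have one: "1 \<in> L1" "1 \<in> L2"
    using subsetD[OF L1(2) Z_1] subsetD[OF L2(2) Z_1] by simp_all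
  let ?I = "left_class scale M1 \<inter> right_class scale M2"
  have inter: "?I = {(\<lambda>x. u * x) ` L1 |u. u \<noteq> 0 \<and> (\<lambda>x. u * x) ` L1 = (\<lambda>x. x * u) ` L2}"
    using L1(3) L2(3) one by (rule class_inter_eq)

  have ab: "(M1, M2) \<in> pi_lr scale \<longleftrightarrow>
      (\<exists>e1 e2. e1 \<noteq> 0 \<and> e2 \<noteq> 0 \<and> (\<lambda>x. e1 * x) ` M1 = (\<lambda>x. x * e2) ` M2)" (is "_ \<longleftrightarrow> ?b")
  proof
    assume "(M1, M2) \<in> pi_lr scale"
    then obtain a b where "a \<noteq> 0" "b \<noteq> 0" "(\<lambda>x. x * b) ` (\<lambda>x. a * x) ` M1 = M2"
      by (auto simp: pi_lr_iff)
    then have "a \<noteq> 0" "inverse b \<noteq> 0" "(\<lambda>x. a * x) ` M1 = (\<lambda>x. x * inverse b) ` M2"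
      by (simp_all add: image_mult_right_eq_iff)
    then show ?b
      by (intro exI conjI)
  next
    assume ?b
    then obtain e1 e2 where e: "e1 \<noteq> 0" "e2 \<noteq> 0" "(\<lambda>x. x * e2) ` M2 = (\<lambda>x. e1 * x) ` M1"
      by auto
    from e(3) have "M2 = (\<lambda>x. x * inverse e2) ` (\<lambda>x. e1 * x) ` M1"
      by (simp only: image_mult_right_eq_iff[OF e(2)])
    moreover have "inverse e2 \<noteq> 0"
      using e(2) by simp
    ultimately show "(M1, M2) \<in> pi_lr scale"
      unfolding pi_lr_iff using assms(2) e(1) by (intro conjI exI)
  qed
  have bc: "?b \<longleftrightarrow> ?I \<noteq> {}"
  proof -
    have "N \<in> ?I \<longleftrightarrow> (\<exists>e1. e1 \<noteq> 0 \<and> N = (\<lambda>x. e1 * x) ` M1) \<and>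
        (\<exists>e2. e2 \<noteq> 0 \<and> N = (\<lambda>x. x * e2) ` M2)" for N
      using assms(2,3) by (simp add: left_class_def right_class_def left_parallel_iff right_parallel_iff)
    then have "?I \<noteq> {} \<longleftrightarrow> (\<exists>N. (\<exists>e1. e1 \<noteq> 0 \<and> N = (\<lambda>x. e1 * x) ` M1) \<and>
        (\<exists>e2. e2 \<noteq> 0 \<and> N = (\<lambda>x. x * e2) ` M2))"
      by (simp only: ex_in_conv[symmetric])
    also have "\<dots> \<longleftrightarrow> ?b"
      by auto
    finally show ?thesis ..
  qed
  have cf: "?I \<noteq> {} \<longleftrightarrow> (\<exists>e. e \<noteq> 0 \<and> (\<lambda>x. inverse e * x * e) ` L1 = L2)" (is "_ \<longleftrightarrow> ?f")
  proof -
    have "?I \<noteq> {} \<longleftrightarrow> (\<exists>u. u \<noteq> 0 \<and> (\<lambda>x. u * x) ` L1 = (\<lambda>x. x * u) ` L2)"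
      unfolding inter by auto
    also have "\<dots> \<longleftrightarrow> (\<exists>e. e \<noteq> 0 \<and> (\<lambda>x. inverse e * x) ` L1 = (\<lambda>x. x * inverse e) ` L2)"
      (is "?u \<longleftrightarrow> ?v")
    proof
      assume ?u
      then obtain u where "u \<noteq> 0" "(\<lambda>x. u * x) ` L1 = (\<lambda>x. x * u) ` L2"
        by auto
      then show ?v
        by (intro exI[of _ "inverse u"]) simp
    next
      assume ?v
      then obtain e where "e \<noteq> 0" "(\<lambda>x. inverse e * x) ` L1 = (\<lambda>x. x * inverse e) ` L2"
        by auto
      then show ?u
        by (intro exI[of _ "inverse e"]) simp
    qed
    also have "\<dots> \<longleftrightarrow> ?f"
      by (simp add: conjugate_iff cong: conj_cong)
    finally show ?thesis .
  qed
  have cd: "?I \<noteq> {} \<longleftrightarrow> (\<exists>M\<in>lines scale. ?I = {M, perp scale M})"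
  proof
    assume "?I \<noteq> {}"
    then obtain e where e: "e \<noteq> 0" "(\<lambda>x. e * x) ` L1 = (\<lambda>x. x * e) ` L2"
      unfolding inter by auto
    obtain i where i: "i \<notin> Z" "L1 = centralizer i"
      using L1(1) one(1) by (rule line_through_1_obtain)
    have "?I = {(\<lambda>x. e * x) ` L1, perp scale ((\<lambda>x. e * x) ` L1)}"
      unfolding inter using class_inter_pair[OF i(1) e(1)] e(2) by (simp only: i(2))
    moreover have "(\<lambda>x. e * x) ` L1 \<in> lines scale"
      using e(1) L1(1) by (rule lines_mult_left)
    ultimately show "\<exists>M\<in>lines scale. ?I = {M, perp scale M}"
      by (intro bexI[of _ "(\<lambda>x. e * x) ` L1"])
  qed auto
  have ef: "F_isomorphic scale L1 L2 \<longleftrightarrow> ?f"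
    using F_isomorphic_conjugate F_isomorphic_imp_conjugate[OF L1(1) one(1) L2(1) one(2)] by auto
  show ?thesis
    using ab bc cf cd ef by simp
qed

end
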